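(* Let $q\in C[0,b]$ be complex valued and let $f$ be a solution of $f''=qf$ on $[0,b]$ with $f(0)=1$ and $f\neq0$ on $[0,b]$. With $\gamma_1,\gamma_2,\mathbf{c}_n,\mathbf{s}_n$ as defined in the context, the following relations hold: $$\gamma_1\mathbf{c}_0=0,\qquad \gamma_1\mathbf{c}_1=1,\qquad \gamma_1\mathbf{s}_1=f^2,$$ $$\gamma_2\gamma_1\mathbf{c}_0=\gamma_2\gamma_1\mathbf{c}_1=0,\qquad \gamma_2\gamma_1\mathbf{s}_1=f-1,$$ $$\gamma_1\mathbf{c}_n(0)=\gamma_1\mathbf{s}_n(0)=0,\qquad n=2,3,\ldots,$$ $$\gamma_2\gamma_1\mathbf{c}_n=n\mathbf{s}_{n-1},\qquad n=1,2,\ldots,$$ $$\gamma_2\gamma_1\mathbf{s}_n=n\mathbf{c}_{n-1},\qquad n=2,3,\ldots,$$ and for all integers $j\ge1$, $n\ge0$, $$(\gamma_2\gamma_1)^j\frac{\mathbf{c}_n}{n!}=\begin{cases}\frac{\mathbf{s}_{n-j}}{(n-j)!} & \text{if } j \text{ is odd and } j<n,\\ \frac{\mathbf{c}_{n-j}}{(n-j)!} & \text{if } j\text{ is even and } j<n,\\ (\gamma_2\gamma_1)^{j-n}[f-1] & \text{if } j\ge n>0 \text{ and } n \text{ is even},\\ 0 & \text{otherwise},\end{cases}$$ $$(\gamma_2\gamma_1)^j\frac{\mathbf{s}_n}{n!}=\begin{cases}\frac{\mathbf{c}_{n-j}}{(n-j)!} & \text{if } j \text{ is odd and } j<n,\\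 \frac{\mathbf{s}_{n-j}}{(n-j)!} & \text{if } j\text{ is even and } j<n,\\ (\gamma_2\gamma_1)^{j-n}[f-1] & \text{if } j\ge n \text{ and } n \text{ is odd},\\ 0 & \text{otherwise}.\end{cases}$$
   Context: Generalized derivatives: $\gamma_1g(x)=f^2(x)\frac{d}{dx}\left(\frac{g(x)}{f(x)}\right)$, $\gamma_2g(x)=\frac12\int_0^x\frac{g'(s)}{f(s)}ds$. On $C^1[0,b]$ the operator $\gamma_2\gamma_1$ is understood in the extended sense $\gamma_2\gamma_1g(x)=\frac12\left(g'(x)-g'(0)-\int_0^x q(s)g(s)\,ds\right)$ (which agrees with the composition for $g\in C^2[0,b]$). $(\gamma_2\gamma_1)^0$ is the identity and $(\gamma_2\gamma_1)^j$ is the $j$-fold iterate. Standing regularity convention: $\gamma_2\gamma_1f=0$, so $(\gamma_2\gamma_1)^i[f-1]=-(\gamma_2\gamma_1)^i[1]$ for $i\ge1$; whenever such a function occurs, $q$ is assumed regular enough for it to be well defined ($q\in W_2^{i-1}[0,b]$). Functions $\varphi_k$: $X^{(0)}\equiv\widetilde X^{(0)}\equiv1$, $X^{(n)}(x)=n\int_0^x X^{(n-1)}(s)\left(f^2(s)\right)^{(-1)^n}ds$, $\widetilde X^{(n)}(x)=n\int_0^x \widetilde X^{(n-1)}(s)\left(f^2(s)\right)^{(-1)^{n-1}}ds$ for $n\ge1$; $\varphi_k=fX^{(k)}$ for $k$ odd, $\varphi_k=f\widetilde X^{(k)}$ for $k$ even. Then $\mathbf{c}_0=f$, $\mathbf{s}_0\equiv0$,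 and for $m\ge1$, $\mathbf{c}_m(x)=\sum_{\text{even }k=0}^m\binom mk x^k\varphi_{m-k}(x)$, $\mathbf{s}_m(x)=\sum_{\text{odd }k=1}^m\binom mk x^k\varphi_{m-k}(x)$. *)

theory Defs
  imports "HOL-Analysis.Analysis"
begin

text \<open>
  Functions on the interval $[0,b]$ are total functions of type \<^typ>\<open>real \<Rightarrow> complex\<close> of which only
  the values on \<^term>\<open>{0..b}\<close> matter; derivatives are taken within \<^term>\<open>{0..b}\<close>, so they are
  one-sided at the end points.
\<close>

abbreviation D_on :: "real \<Rightarrow> (real \<Rightarrow> complex) \<Rightarrow> real \<Rightarrow> complex" where
  "D_on b g x \<equiv> vector_derivative g (at x within {0..b})"

definition C1_on :: "real \<Rightarrow> (real \<Rightarrow> complex) \<Rightarrow> bool" where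
  "C1_on b g \<longleftrightarrow>
     (\<exists>g'. (\<forall>x\<in>{0..b}. (g has_vector_derivative g' x) (at x within {0..b}))
         \<and> continuous_on {0..b} g')"

definition solves_ode :: "real \<Rightarrow> (real \<Rightarrow> complex) \<Rightarrow> (real \<Rightarrow> complex) \<Rightarrow> bool" where
  "solves_ode b q f \<longleftrightarrow>
     (\<exists>f'. (\<forall>x\<in>{0..b}. (f has_vector_derivative f' x) (at x within {0..b}))
         \<and> (\<forall>x\<in>{0..b}. (f' has_vector_derivative q x * f x) (at x within {0..b})))"

text \<open>
  The Sobolev space $W_2^k[0,b]$: for $k = 0$ it is $L_2(0,b)$, and a function is in $W_2^{k+1}[0,b]$
  iff it is absolutely continuous, i.e. an indefinite Lebesgue integral, with derivative in
  $W_2^k[0,b]$. The integral below is the Henstock--Kurzweil one, which agrees with the Lebesgue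
  integral because the integrand is in $L_2(0,b)$. For $k \ge 1$ the identity is required at
  every point, that is, the continuous representative is meant.
\<close>

fun W2 :: "nat \<Rightarrow> real \<Rightarrow> (real \<Rightarrow> complex) \<Rightarrow> bool" where
  "W2 0 b g \<longleftrightarrow>
     g \<in> borel_measurable (lebesgue_on {0..b}) \<and>
     integrable (lebesgue_on {0..b}) (\<lambda>x. (norm (g x))\<^sup>2)"
| "W2 (Suc k) b g \<longleftrightarrow>
     (\<exists>h. W2 k b h \<and> (\<forall>x\<in>{0..b}. g x = g 0 + integral {0..x} h))"

definition gamma1 :: "real \<Rightarrow> (real \<Rightarrow> complex) \<Rightarrow> (real \<Rightarrow> complex) \<Rightarrow> real \<Rightarrow> complex" where
  "gamma1 b f g x = (f x)\<^sup>2 * D_on b (\<lambda>t. g t / f t) x"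

definition gamma2 :: "real \<Rightarrow> (real \<Rightarrow> complex) \<Rightarrow> (real \<Rightarrow> complex) \<Rightarrow> real \<Rightarrow> complex" where
  "gamma2 b f g x = 1 / 2 * integral {0..x} (\<lambda>s. D_on b g s / f s)"

text \<open>
  The operator $\gamma_2\gamma_1$ on $C^1[0,b]$ in the extended sense; it agrees with the composition
  on $C^2[0,b]$, see \<open>gamma2_gamma1_eq\<close> below.
\<close>

definition gamma21 :: "real \<Rightarrow> (real \<Rightarrow> complex) \<Rightarrow> (real \<Rightarrow> complex) \<Rightarrow> real \<Rightarrow> complex" where
  "gamma21 b q g x = 1 / 2 * (D_on b g x - D_on b g 0 - integral {0..x} (\<lambda>s. q s * g s))"

text \<open>
  \<^const>\<open>gamma21\<close> is a total function here, whereas the operator has domain $C^1[0,b]$. The following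
  predicate says that $(\gamma_2\gamma_1)^j g$ is well defined: each of the $j$ applications is to a
  function in $C^1[0,b]$.
\<close>

definition iterate_defined :: "real \<Rightarrow> (real \<Rightarrow> complex) \<Rightarrow> nat \<Rightarrow> (real \<Rightarrow> complex) \<Rightarrow> bool" where
  "iterate_defined b q j g \<longleftrightarrow> (\<forall>i<j. C1_on b ((gamma21 b q ^^ i) g))"

fun X :: "(real \<Rightarrow> complex) \<Rightarrow> nat \<Rightarrow> real \<Rightarrow> complex" where
  "X f 0 x = 1"
| "X f (Suc n) x =
     of_nat (Suc n) * integral {0..x} (\<lambda>s. X f n s * ((f s)\<^sup>2) powi ((-1) ^ Suc n))"

fun X_tilde :: "(real \<Rightarrow> complex) \<Rightarrow> nat \<Rightarrow> real \<Rightarrow> complex" where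
  "X_tilde f 0 x = 1"
| "X_tilde f (Suc n) x =
     of_nat (Suc n) * integral {0..x} (\<lambda>s. X_tilde f n s * ((f s)\<^sup>2) powi ((-1) ^ n))"

definition phi :: "(real \<Rightarrow> complex) \<Rightarrow> nat \<Rightarrow> real \<Rightarrow> complex" where
  "phi f k x = (if odd k then f x * X f k x else f x * X_tilde f k x)"

definition c_fun :: "(real \<Rightarrow> complex) \<Rightarrow> nat \<Rightarrow> real \<Rightarrow> complex" where
  "c_fun f m x =
     (if m = 0 then f x
      else \<Sum>k | k \<le> m \<and> even k. of_nat (m choose k) * of_real x ^ k * phi f (m - k) x)"

definition s_fun :: "(real \<Rightarrow> complex) \<Rightarrow> nat \<Rightarrow> real \<Rightarrow> complex" where
  "s_fun f m x =
     (if m = 0 then 0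
      else \<Sum>k | k \<le> m \<and> odd k. of_nat (m choose k) * of_real x ^ k * phi f (m - k) x)"

lemma D_on_eq:
  assumes "0 < b" "x \<in> {0..b}" "(g has_vector_derivative d) (at x within {0..b})"
  shows "D_on b g x = d"
  using assms by (intro vector_derivative_within_cbox[of 0 b, simplified]) auto

lemma gamma2_gamma1_eq:
  fixes b :: real and q f g g' g'' :: "real \<Rightarrow> complex"
  assumes b: "0 < b" and f: "solves_ode b q f" and nz: "\<forall>x\<in>{0..b}. f x \<noteq> 0"
    and q: "continuous_on {0..b} q"
    and g: "\<And>x. x \<in> {0..b} \<Longrightarrow> (g has_vector_derivative g' x) (at x within {0..b})"
    and g': "\<And>x. x \<in> {0..b} \<Longrightarrow> (g' has_vector_derivative g'' x) (at x within {0..b})"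
    and x: "x \<in> {0..b}"
  shows "gamma2 b f (gamma1 b f g) x = gamma21 b q g x"
proof -
  from f obtain f' where f1: "\<And>x. x \<in> {0..b} \<Longrightarrow> (f has_vector_derivative f' x) (at x within {0..b})"
    and f2: "\<And>x. x \<in> {0..b} \<Longrightarrow> (f' has_vector_derivative q x * f x) (at x within {0..b})"
    unfolding solves_ode_def by blast
  have 1: "gamma1 b f g t = f t * g' t - f' t * g t" if t: "t \<in> {0..b}" for t
  proof -
    have "((\<lambda>t. g t / f t) has_vector_derivative (g' t * f t - g t * f' t) / (f t * f t)) (at t within {0..b})"
    proof -
      have fi: "((\<lambda>t. inverse (f t)) has_vector_derivative (- f' t / (f t * f t))) (at t within {0..b})"
      proof -
        have "(inverse has_field_derivative (- (inverse (f t * f t)))) (at (f t) within f ` {0..b})"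
          using nz t by (auto intro!: derivative_eq_intros simp: field_simps)
        from field_vector_diff_chain_within[OF f1[OF t] this] show ?thesis
          by (simp add: o_def divide_inverse)
      qed
      have "((\<lambda>t. g t * inverse (f t)) has_vector_derivative
              g t * (- f' t / (f t * f t)) + g' t * inverse (f t)) (at t within {0..b})"
        using has_vector_derivative_mult[OF g[OF t] fi] by simp
      moreover have "g t * (- f' t / (f t * f t)) + g' t * inverse (f t) = (g' t * f t - g t * f' t) / (f t * f t)"
        using nz t by (simp add: field_simps)
      ultimately show ?thesis by (simp add: divide_inverse)
    qed
    note d = D_on_eq[OF b t this]
    show ?thesis
      unfolding gamma1_def d using nz t by (simp add: power2_eq_square field_simps)
  qed
  have 2: "D_on b (gamma1 b f g) t = f t * g'' t - q t * f t * g t" if t: "t \<in> {0..b}" for t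
  proof -
    have "((\<lambda>t. f t * g' t - f' t * g t) has_vector_derivative
        (f t * g'' t + f' t * g' t) - (f' t * g' t + q t * f t * g t)) (at t within {0..b})"
      by (intro has_vector_derivative_diff has_vector_derivative_mult f1 f2 g g' t)
    from D_on_eq[OF b t has_vector_derivative_transform[OF t 1 this]] show ?thesis
      by simp
  qed
  have sub: "{0..x} \<subseteq> {0..b}" using x by auto
  have "(g'' has_integral g' x - g' 0) {0..x}"
    using x sub by (intro fundamental_theorem_of_calculus)
      (auto intro: has_vector_derivative_within_subset[OF g'])
  moreover have "(\<lambda>s. q s * g s) integrable_on {0..x}"
  proof (rule integrable_continuous_real)
    have "continuous_on {0..b} g"
      by (rule continuous_on_vector_derivative[OF g])
    then show "continuous_on {0..x} (\<lambda>s. q s * g s)"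
      using q sub by (intro continuous_on_mult) (auto intro: continuous_on_subset)
  qed
  ultimately have "((\<lambda>s. g'' s - q s * g s) has_integral
      g' x - g' 0 - integral {0..x} (\<lambda>s. q s * g s)) {0..x}"
    by (intro has_integral_diff integrable_integral)
  then have "integral {0..x} (\<lambda>s. g'' s - q s * g s)
      = g' x - g' 0 - integral {0..x} (\<lambda>s. q s * g s)"
    by (rule integral_unique)
  moreover have "integral {0..x} (\<lambda>s. D_on b (gamma1 b f g) s / f s) = integral {0..x} (\<lambda>s. g'' s - q s * g s)"
  proof (rule integral_cong)
    fix s assume "s \<in> {0..x}"
    then have s: "s \<in> {0..b}" using sub by blast
    with nz have "f s \<noteq> 0" by blast
    then show "D_on b (gamma1 b f g) s / f s = g'' s - q s * g s"
      unfolding 2[OF s] by (simp add: field_simps)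
  qed
  moreover have "D_on b g x = g' x" "D_on b g 0 = g' 0"
    using b x by (auto intro!: D_on_eq g)
  ultimately show ?thesis by (simp add: gamma2_def gamma21_def)
qed

end

theory Submission
  imports Defs
begin

text \<open>
  The identities rest on one differential equation. For $\varepsilon = \pm 1$ put
  \[ u_m^\varepsilon(x) = \sum_{k \le m} \binom mk (\varepsilon x)^k \varphi_{m-k}(x). \]
  Sorting by the parity of $k$ gives $\mathbf{c}_m = (u_m^{+} + u_m^{-})/2$ and
  $\mathbf{s}_m = (u_m^{+} - u_m^{-})/2$. The formal powers satisfy
  $\varphi_k'' - q\varphi_k = k(k-1)\varphi_{k-2}$ (\<open>phi'_deriv\<close>), as $x^k$ does for $q = 0$ and
  $f = 1$, where $u_m^\varepsilon = (x + \varepsilon x)^m$. Since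
  $\binom mk$ absorbs a factor $k$ or $m - k$ by lowering $m$, differentiating twice gives
  \[ (u_m^\varepsilon)'' - q\,u_m^\varepsilon = 2\varepsilon m\,(u_{m-1}^\varepsilon)' \]
  (\<open>wave'_deriv\<close>). The factor $\varepsilon$ exchanges the even and the odd part, so
  $\mathbf{c}_m'' - q\mathbf{c}_m = 2m\,\mathbf{s}_{m-1}'$ and
  $\mathbf{s}_m'' - q\mathbf{s}_m = 2m\,\mathbf{c}_{m-1}'$.

  If $g'' - qg = 2h'$, then integrating from $0$ to $x$ shows $\gamma_2\gamma_1 g = h - h(0)$
  (\<open>gamma21_eq_diff\<close>). Hence $\gamma_2\gamma_1$ sends $\mathbf{c}_m$ to $m\mathbf{s}_{m-1}$ and
  $\mathbf{s}_m$ to $m(\mathbf{c}_{m-1} - \mathbf{c}_{m-1}(0))$; the constant is nonzero only for $m = 1$,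
  where $\mathbf{c}_0(0) = f(0) = 1$ and the image is $f - 1$.

  The iterates then walk down the index, alternating between $\mathbf{c}$ and $\mathbf{s}$, until the
  index is $1$. A walk that arrives at $\mathbf{c}_1$ stops at $0$, and one that arrives at $\mathbf{s}_1$
  continues with the iterates on $f - 1$ (\<open>gamma21_iterate_alternating\<close>). The latter are well
  defined because $\gamma_2\gamma_1[f-1](x) = \frac12\int_0^x q(s)\,ds$ has one derivative more than $q$, and
  each further application costs one derivative
  (\<open>C1_on_gamma21_iterate_f_minus_1\<close>).
\<close>

section \<open>Binomial convolutions\<close>

definition binom_conv :: "(nat \<Rightarrow> complex) \<Rightarrow> nat \<Rightarrow> complex \<Rightarrow> complex" where
  "binom_conv a m t = (\<Sum>k\<le>m. of_nat (m choose k) * t ^ k * a (m - k))"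

lemma binom_conv_0: "binom_conv a m 0 = a m"
  by (simp add: binom_conv_def sum.atMost_shift)

text \<open>
  This is the case of a sequence with $a_j' = j\,a_{j-1}$: the factor $m - k$ is absorbed by
  $(m-k)\binom mk = m\binom{m-1}k$. The truncated \<^term>\<open>j - 1\<close> at $j = 0$ is harmless, as its weight
  vanishes.
\<close>

lemma binom_conv_weight_index:
  "binom_conv (\<lambda>j. of_nat j * a (j - 1)) m t = of_nat m * binom_conv a (m - 1) t"
proof (cases m)
  case 0
  then show ?thesis by (simp add: binom_conv_def)
next
  case (Suc n)
  have "of_nat (Suc n choose k) * t ^ k * (of_nat (Suc n - k) * a (Suc n - k - 1))
      = of_nat (Suc n) * (of_nat (n choose k) * t ^ k * a (n - k))" if "k \<le> n" for k
  proof -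
    have "(Suc n - k) * (Suc n choose k) = Suc n * (n choose k)"
      using binomial_absorb_comp[of "Suc n" k] by simp
    then have "of_nat (Suc n - k) * of_nat (Suc n choose k) = (of_nat (Suc n) * of_nat (n choose k) :: complex)"
      by (metis of_nat_mult)
    then have "(of_nat (Suc n - k) * of_nat (Suc n choose k)) * (t ^ k * a (n - k))
        = (of_nat (Suc n) * of_nat (n choose k)) * (t ^ k * a (n - k))"
      by (simp only:)
    moreover have "Suc n - k - 1 = n - k" by simp
    ultimately show ?thesis by (simp only: ac_simps)
  qed
  then have "(\<Sum>k\<le>n. of_nat (Suc n choose k) * t ^ k * (of_nat (Suc n - k) * a (Suc n - k - 1)))
      = (\<Sum>k\<le>n. of_nat (Suc n) * (of_nat (n choose k) * t ^ k * a (n - k)))"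
    by (intro sum.cong) auto
  then show ?thesis unfolding Suc binom_conv_def by (simp add: sum_distrib_left del: of_nat_Suc of_nat_diff)
qed

text \<open>
  The part of the product rule in which the power of $t$ is differentiated; here
  $k\binom mk = m\binom{m-1}{k-1}$ absorbs the exponent.
\<close>

lemma binom_conv_formal_deriv:
  "(\<Sum>k\<le>m. of_nat (m choose k) * (of_nat k * t ^ (k - 1)) * a (m - k)) = of_nat m * binom_conv a (m - 1) t"
proof (cases m)
  case 0
  then show ?thesis by simp
next
  case (Suc n)
  have "of_nat (Suc n choose Suc k) * (of_nat (Suc k) * t ^ k) * a (n - k)
      = of_nat (Suc n) * (of_nat (n choose k) * t ^ k * a (n - k))" for k
  proof -
    have "of_nat (Suc k) * of_nat (Suc n choose Suc k) = (of_nat (Suc n) * of_nat (n choose k) :: complex)"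
      by (metis of_nat_mult Suc_times_binomial)
    then have "(of_nat (Suc k) * of_nat (Suc n choose Suc k)) * (t ^ k * a (n - k))
        = (of_nat (Suc n) * of_nat (n choose k)) * (t ^ k * a (n - k))"
      by (simp only:)
    then show ?thesis by (simp only: ac_simps)
  qed
  then have "(\<Sum>k\<le>n. of_nat (Suc n choose Suc k) * (of_nat (Suc k) * t ^ k) * a (n - k))
      = (\<Sum>k\<le>n. of_nat (Suc n) * (of_nat (n choose k) * t ^ k * a (n - k)))"
    by (intro sum.cong) auto
  then show ?thesis unfolding Suc binom_conv_def
    by (subst sum.atMost_Suc_shift) (simp add: sum_distrib_left del: of_nat_Suc binomial_Suc_Suc)
qed

lemma has_vector_derivative_binom_conv:
  assumes "\<And>j. (a j has_vector_derivative a' j) (at x within S)"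
  shows "((\<lambda>y. binom_conv (\<lambda>j. a j y) m (\<epsilon> * of_real y)) has_vector_derivative
     \<epsilon> * (of_nat m * binom_conv (\<lambda>j. a j x) (m - 1) (\<epsilon> * of_real x))
       + binom_conv a' m (\<epsilon> * of_real x)) (at x within S)"
proof -
  have power: "((\<lambda>y. (\<epsilon> * of_real y) ^ k) has_vector_derivative
      \<epsilon> * (of_nat k * (\<epsilon> * of_real x) ^ (k - 1))) (at x within S)" for k
    by (rule has_vector_derivative_real_field) (auto intro!: derivative_eq_intros)
  have "((\<lambda>y. of_nat (m choose k) * (\<epsilon> * of_real y) ^ k * a (m - k) y) has_vector_derivative
      of_nat (m choose k) * (\<epsilon> * of_real x) ^ k * a' (m - k)
      + of_nat (m choose k) * (\<epsilon> * (of_nat k * (\<epsilon> * of_real x) ^ (k - 1))) * a (m - k) x) (at x within S)" for k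
    by (intro has_vector_derivative_mult has_vector_derivative_mult_right power assms)
  then have "((\<lambda>y. binom_conv (\<lambda>j. a j y) m (\<epsilon> * of_real y)) has_vector_derivative
      (\<Sum>k\<le>m. of_nat (m choose k) * (\<epsilon> * of_real x) ^ k * a' (m - k)
      + of_nat (m choose k) * (\<epsilon> * (of_nat k * (\<epsilon> * of_real x) ^ (k - 1))) * a (m - k) x)) (at x within S)"
    unfolding binom_conv_def by (intro has_vector_derivative_sum)
  also have "(\<Sum>k\<le>m. of_nat (m choose k) * (\<epsilon> * of_real x) ^ k * a' (m - k)
      + of_nat (m choose k) * (\<epsilon> * (of_nat k * (\<epsilon> * of_real x) ^ (k - 1))) * a (m - k) x)
      = \<epsilon> * (\<Sum>k\<le>m. of_nat (m choose k) * (of_nat k * (\<epsilon> * of_real x) ^ (k - 1)) * a (m - k) x)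
       + binom_conv a' m (\<epsilon> * of_real x)"
    by (simp add: binom_conv_def sum.distrib sum_distrib_left ac_simps)
  finally show ?thesis by (simp only: binom_conv_formal_deriv[of m _ "\<lambda>j. a j x"])
qed

lemma c_fun_eq_binom_conv:
  "c_fun f m x = 1/2 * binom_conv (\<lambda>j. phi f j x) m (of_real x) + 1/2 * binom_conv (\<lambda>j. phi f j x) m (- of_real x)"
proof -
  have "(\<Sum>k | k \<le> m \<and> even k. of_nat (m choose k) * of_real x ^ k * phi f (m - k) x)
      = (\<Sum>k\<le>m. if even k then of_nat (m choose k) * of_real x ^ k * phi f (m - k) x else 0)"
    by (simp add: sum.inter_filter[symmetric])
  also have "\<dots> = 1/2 * binom_conv (\<lambda>j. phi f j x) m (of_real x) + 1/2 * binom_conv (\<lambda>j. phi f j x) m (- of_real x)"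
    unfolding binom_conv_def sum_distrib_left sum.distrib[symmetric]
    by (intro sum.cong) (auto simp: power_minus_odd)
  finally show ?thesis
    by (cases "m = 0") (simp_all add: c_fun_def binom_conv_def phi_def)
qed

lemma s_fun_eq_binom_conv:
  "s_fun f m x = 1/2 * binom_conv (\<lambda>j. phi f j x) m (of_real x) - 1/2 * binom_conv (\<lambda>j. phi f j x) m (- of_real x)"
proof -
  have "(\<Sum>k | k \<le> m \<and> odd k. of_nat (m choose k) * of_real x ^ k * phi f (m - k) x)
      = (\<Sum>k\<le>m. if odd k then of_nat (m choose k) * of_real x ^ k * phi f (m - k) x else 0)"
    by (simp add: sum.inter_filter[symmetric])
  also have "\<dots> = 1/2 * binom_conv (\<lambda>j. phi f j x) m (of_real x) - 1/2 * binom_conv (\<lambda>j. phi f j x) m (- of_real x)"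
    unfolding binom_conv_def sum_distrib_left sum_subtractf[symmetric]
    by (intro sum.cong) (auto simp: power_minus_odd)
  finally show ?thesis
    by (cases "m = 0") (simp_all add: s_fun_def binom_conv_def phi_def)
qed

section \<open>Smoothness classes on an interval\<close>

text \<open>
  The iterates of \<^const>\<open>gamma21\<close> lose one derivative at each step, so derivatives have to be
  counted. The recursion peels off the first derivative, as \<^const>\<open>W2\<close> does, which lets the comparison
  with \<^const>\<open>W2\<close> go by induction.
\<close>

fun Ck_on :: "nat \<Rightarrow> real \<Rightarrow> (real \<Rightarrow> complex) \<Rightarrow> bool" where
  "Ck_on 0 b g \<longleftrightarrow> continuous_on {0..b} g"
| "Ck_on (Suc k) b g \<longleftrightarrow>
     (\<exists>g'. (\<forall>x\<in>{0..b}. (g has_vector_derivative g' x) (at x within {0..b})) \<and> Ck_on k b g')"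

lemma C1_on_iff: "C1_on b g \<longleftrightarrow> Ck_on (Suc 0) b g"
  by (simp add: C1_on_def)

lemma Ck_on_Suc_imp: "Ck_on (Suc k) b g \<Longrightarrow> Ck_on k b g"
proof (induction k arbitrary: g)
  case 0
  then show ?case by (auto intro: continuous_on_vector_derivative)
next
  case (Suc k)
  then obtain g' where g': "\<forall>x\<in>{0..b}. (g has_vector_derivative g' x) (at x within {0..b})"
    and "Ck_on (Suc k) b g'" by auto
  then have "Ck_on k b g'" by (intro Suc.IH)
  with g' show ?case by auto
qed

lemma Ck_on_antimono: "k \<le> l \<Longrightarrow> Ck_on l b g \<Longrightarrow> Ck_on k b g"
  by (induction l rule: dec_induct) (auto dest: Ck_on_Suc_imp simp del: Ck_on.simps)

lemma Ck_on_cong: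
  assumes "\<And>x. x \<in> {0..b} \<Longrightarrow> g x = h x"
  shows "Ck_on k b g \<longleftrightarrow> Ck_on k b h"
proof (cases k)
  case 0
  then show ?thesis using assms by (auto intro: continuous_on_eq)
next
  case (Suc l)
  have "(g has_vector_derivative d) (at x within {0..b}) \<longleftrightarrow> (h has_vector_derivative d) (at x within {0..b})"
    if "x \<in> {0..b}" for x d
    using that assms by (metis has_vector_derivative_transform)
  then show ?thesis by (simp add: Suc)
qed

lemma Ck_on_const: "Ck_on k b (\<lambda>x. c)"
proof (induction k arbitrary: c)
  case (Suc k)
  from Suc[of 0] show ?case by (auto intro!: exI[of _ "\<lambda>_. 0"])
qed simp

lemma Ck_on_diff: "Ck_on k b g \<Longrightarrow> Ck_on k b h \<Longrightarrow> Ck_on k b (\<lambda>x. g x - h x)"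
proof (induction k arbitrary: g h)
  case 0
  then show ?case by (auto intro: continuous_on_diff)
next
  case (Suc k)
  then obtain g' h' where "\<forall>x\<in>{0..b}. (g has_vector_derivative g' x) (at x within {0..b})" "Ck_on k b g'"
    "\<forall>x\<in>{0..b}. (h has_vector_derivative h' x) (at x within {0..b})" "Ck_on k b h'" by auto
  with Suc.IH[of g' h'] show ?case
    by (auto intro!: exI[of _ "\<lambda>x. g' x - h' x"] has_vector_derivative_diff)
qed

lemma Ck_on_add: "Ck_on k b g \<Longrightarrow> Ck_on k b h \<Longrightarrow> Ck_on k b (\<lambda>x. g x + h x)"
  using Ck_on_diff[of k b g "\<lambda>x. 0 - h x"] Ck_on_diff[of k b "\<lambda>x. 0" h] Ck_on_const[of k b 0] by simp

lemma Ck_on_mult: "Ck_on k b g \<Longrightarrow> Ck_on k b h \<Longrightarrow> Ck_on k b (\<lambda>x. g x * h x)"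
proof (induction k arbitrary: g h)
  case 0
  then show ?case by (auto intro: continuous_on_mult)
next
  case (Suc k)
  then obtain g' h' where *: "\<forall>x\<in>{0..b}. (g has_vector_derivative g' x) (at x within {0..b})" "Ck_on k b g'"
    "\<forall>x\<in>{0..b}. (h has_vector_derivative h' x) (at x within {0..b})" "Ck_on k b h'" by auto
  have "Ck_on k b (\<lambda>x. g x * h' x + g' x * h x)"
    using * Ck_on_Suc_imp[OF Suc.prems(1)] Ck_on_Suc_imp[OF Suc.prems(2)]
    by (intro Ck_on_add Suc.IH)
  with * show ?case
    by (auto intro!: exI[of _ "\<lambda>x. g x * h' x + g' x * h x"] has_vector_derivative_mult)
qed

lemma Ck_on_integral:
  assumes "Ck_on k b g"
  shows "Ck_on (Suc k) b (\<lambda>x. integral {0..x} g)"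
proof -
  have "Ck_on 0 b g" using assms by (rule Ck_on_antimono[rotated]) simp
  then have "\<forall>x\<in>{0..b}. ((\<lambda>x. integral {0..x} g) has_vector_derivative g x) (at x within {0..b})"
    by (auto intro: integral_has_vector_derivative)
  with assms show ?thesis by auto
qed

lemma C1_on_cong:
  assumes "\<And>x. x \<in> {0..b} \<Longrightarrow> g x = h x"
  shows "C1_on b g \<longleftrightarrow> C1_on b h"
  unfolding C1_on_iff using assms by (rule Ck_on_cong)

lemma C1_on_zero: "C1_on b (\<lambda>_. 0)"
  unfolding C1_on_iff by (rule Ck_on_const)

lemma W2_0_integrable_on:
  assumes "W2 0 b g"
  shows "g integrable_on {0..b}"
proof -
  have "integrable (lebesgue_on {0..b}) g"
  proof (rule Bochner_Integration.integrable_bound)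
    show "integrable (lebesgue_on {0..b}) (\<lambda>x. 1 + (norm (g x))\<^sup>2)"
      using assms by (intro Bochner_Integration.integrable_add) (auto simp: integrable_restrict_space)
    \<comment> \<open>$(|z| - \frac12)^2 \ge 0$ bounds $|g|$ by an integrable function on a set of finite measure.\<close>
    have "norm z \<le> 1 + (norm z)\<^sup>2" for z :: complex
      using zero_le_power2[of "norm z - 1/2"] by (simp add: power2_diff power_divide)
    then show "AE x in lebesgue_on {0..b}. norm (g x) \<le> norm (1 + (norm (g x))\<^sup>2)"
      by simp
  qed (use assms in simp)
  then show ?thesis by (rule integrable_on_lebesgue_on) simp
qed

text \<open>
  The one-dimensional Sobolev embedding $W_2^{k+1} \subseteq C^k$. At the bottom an indefinite integral of
  an $L_2$ function is continuous; above it, the integrand is continuous by induction and is therefore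
  the classical derivative.
\<close>

lemma W2_Suc_imp_Ck_on: "W2 (Suc k) b g \<Longrightarrow> Ck_on k b g"
proof (induction k arbitrary: g)
  case 0
  then obtain h where h: "W2 0 b h" "\<And>x. x \<in> {0..b} \<Longrightarrow> g x = g 0 + integral {0..x} h"
    unfolding W2.simps by blast
  have "continuous_on {0..b} (\<lambda>x. g 0 + integral {0..x} h)"
    by (intro continuous_intros indefinite_integral_continuous_1 W2_0_integrable_on h)
  then show ?case unfolding Ck_on.simps by (rule continuous_on_eq) (rule h(2)[symmetric])
next
  case (Suc k)
  then obtain h where h: "W2 (Suc k) b h" "\<And>x. x \<in> {0..b} \<Longrightarrow> g x = g 0 + integral {0..x} h"
    unfolding W2.simps(2)[of "Suc k"] by blast
  have "Ck_on (Suc k) b (\<lambda>x. g 0 + integral {0..x} h)"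
    by (intro Ck_on_add Ck_on_const Ck_on_integral Suc.IH h)
  then show ?case by (subst Ck_on_cong[OF h(2)])
qed

section \<open>The operator \<open>gamma21\<close> and its iterates\<close>

text \<open>
  Applying an identity that holds on $[0,b]$ below another application of \<^const>\<open>gamma21\<close> requires
  that \<^const>\<open>gamma21\<close> depend only on the values in $[0,b]$. It does so even where a derivative
  fails to exist: \<^const>\<open>vector_derivative\<close> chooses among all admissible values, and these are the
  same for both functions.
\<close>

lemma D_on_cong:
  assumes "\<And>x. x \<in> {0..b} \<Longrightarrow> g x = h x" "x \<in> {0..b}"
  shows "D_on b g x = D_on b h x"
proof -
  have "(g has_vector_derivative d) (at x within {0..b}) \<longleftrightarrow> (h has_vector_derivative d) (at x within {0..b})" for d
    using assms by (metis has_vector_derivative_transform)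
  then show ?thesis by (simp add: vector_derivative_def)
qed

lemma gamma21_cong:
  assumes "\<And>x. x \<in> {0..b} \<Longrightarrow> g x = h x" "x \<in> {0..b}"
  shows "gamma21 b q g x = gamma21 b q h x"
proof -
  have "integral {0..x} (\<lambda>s. q s * g s) = integral {0..x} (\<lambda>s. q s * h s)"
    using assms by (intro integral_cong) auto
  moreover have "D_on b g 0 = D_on b h 0" "D_on b g x = D_on b h x"
    using assms by (auto intro!: D_on_cong)
  ultimately show ?thesis by (simp add: gamma21_def)
qed

lemma gamma21_iterate_cong:
  assumes "\<And>x. x \<in> {0..b} \<Longrightarrow> g x = h x" "x \<in> {0..b}"
  shows "(gamma21 b q ^^ i) g x = (gamma21 b q ^^ i) h x"
  using assms(2)
proof (induction i arbitrary: x)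
  case (Suc i)
  then show ?case by (auto intro: gamma21_cong)
qed (use assms in simp)

lemma gamma21_zero:
  assumes "0 < b" "x \<in> {0..b}"
  shows "gamma21 b q (\<lambda>_. 0) x = 0"
proof -
  have "D_on b (\<lambda>_. 0) y = 0" if "y \<in> {0..b}" for y
    using assms(1) that by (intro D_on_eq) auto
  then show ?thesis using assms by (simp add: gamma21_def)
qed

lemma gamma21_iterate_zero:
  assumes "0 < b" "x \<in> {0..b}"
  shows "(gamma21 b q ^^ i) (\<lambda>_. 0) x = 0"
  using assms(2)
proof (induction i arbitrary: x)
  case (Suc i)
  then have "gamma21 b q ((gamma21 b q ^^ i) (\<lambda>_. 0)) x = gamma21 b q (\<lambda>_. 0) x"
    by (intro gamma21_cong)
  then show ?case using assms(1) Suc.prems by (simp add: gamma21_zero)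
qed simp

text \<open>
  Two sequences that \<^const>\<open>gamma21\<close> maps to each other with a drop of the index. After $n - 1$
  steps the index is $1$ and the parity of $n$ decides in which sequence the walk has ended.
  The hypotheses are symmetric in \<^term>\<open>A\<close> and \<^term>\<open>B\<close>, so one statement serves $\mathbf{c}_n$ and
  $\mathbf{s}_n$.
\<close>

lemma gamma21_iterate_alternating:
  fixes A B :: "nat \<Rightarrow> real \<Rightarrow> complex" and A_end B_end :: "real \<Rightarrow> complex"
  assumes A: "\<And>n x. 2 \<le> n \<Longrightarrow> x \<in> {0..b} \<Longrightarrow> gamma21 b q (A n) x = B (n - 1) x"
    and B: "\<And>n x. 2 \<le> n \<Longrightarrow> x \<in> {0..b} \<Longrightarrow> gamma21 b q (B n) x = A (n - 1) x"
    and A1: "\<And>x. x \<in> {0..b} \<Longrightarrow> gamma21 b q (A 1) x = A_end x"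
    and B1: "\<And>x. x \<in> {0..b} \<Longrightarrow> gamma21 b q (B 1) x = B_end x"
    and n: "1 \<le> n" and x: "x \<in> {0..b}"
  shows "(gamma21 b q ^^ i) (A n) x =
    (if i < n then if even i then A (n - i) x else B (n - i) x
     else (gamma21 b q ^^ (i - n)) (if odd n then A_end else B_end) x)"
proof -
  have below: "(gamma21 b q ^^ j) (A n) y = (if even j then A (n - j) y else B (n - j) y)"
    if "j < n" "y \<in> {0..b}" for j y
    using that
  proof (induction j arbitrary: y)
    case (Suc j)
    have "(gamma21 b q ^^ Suc j) (A n) y = gamma21 b q (if even j then A (n - j) else B (n - j)) y"
      using Suc by (auto intro!: gamma21_cong)
    also have "\<dots> = (if even j then B (n - j - 1) y else A (n - j - 1) y)"
      using Suc.prems A B by simp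
    finally show ?case by simp
  qed simp
  have at_n: "(gamma21 b q ^^ n) (A n) y = (if odd n then A_end else B_end) y" if y: "y \<in> {0..b}" for y
  proof -
    obtain m where m: "n = Suc m" using n by (cases n) auto
    have "(gamma21 b q ^^ n) (A n) y = gamma21 b q (if even m then A 1 else B 1) y"
      using below[of m] y by (auto simp: m intro!: gamma21_cong)
    then show ?thesis using A1 B1 y by (simp add: m)
  qed
  show ?thesis
  proof (cases "i < n")
    case False
    then have "(gamma21 b q ^^ i) (A n) x = (gamma21 b q ^^ (i - n)) ((gamma21 b q ^^ n) (A n)) x"
      by (metis comp_apply funpow_add le_add_diff_inverse2 not_less)
    with False show ?thesis
      using gamma21_iterate_cong[OF at_n x, where i = "i - n"] by simp
  qed (use below x in simp)
qed

section \<open>Nonvanishing solutions and the extended operator\<close>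

locale nonvanishing_solution =
  fixes b :: real and q f f' :: "real \<Rightarrow> complex"
  assumes b_pos: "0 < b"
    and q_cont: "continuous_on {0..b} q"
    and f_deriv: "x \<in> {0..b} \<Longrightarrow> (f has_vector_derivative f' x) (at x within {0..b})"
    and f'_deriv: "x \<in> {0..b} \<Longrightarrow> (f' has_vector_derivative q x * f x) (at x within {0..b})"
    and f_0: "f 0 = 1"
    and f_nonzero: "x \<in> {0..b} \<Longrightarrow> f x \<noteq> 0"
begin

lemma f_cont: "continuous_on {0..b} f"
  by (rule continuous_on_vector_derivative[OF f_deriv])

lemma inverse_f_deriv:
  assumes x: "x \<in> {0..b}"
  shows "((\<lambda>x. inverse (f x)) has_vector_derivative - f' x / (f x)\<^sup>2) (at x within {0..b})"
proof -
  have "(inverse has_field_derivative - (inverse (f x * f x))) (at (f x) within f ` {0..b})"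
    using f_nonzero[OF x] by (auto intro!: derivative_eq_intros simp: field_simps)
  from field_vector_diff_chain_within[OF f_deriv[OF x] this] show ?thesis
    by (simp add: o_def divide_inverse power2_eq_square)
qed

text \<open>
  $\gamma_1 g$ is the Wronskian of $f$ and $g$, by the quotient rule.
\<close>

lemma gamma1_eq:
  assumes x: "x \<in> {0..b}" and g: "(g has_vector_derivative d) (at x within {0..b})"
  shows "gamma1 b f g x = f x * d - f' x * g x"
proof -
  have "((\<lambda>t. g t * inverse (f t)) has_vector_derivative g x * (- f' x / (f x)\<^sup>2) + d * inverse (f x)) (at x within {0..b})"
    by (intro has_vector_derivative_mult g inverse_f_deriv x)
  from D_on_eq[OF b_pos x this] show ?thesis
    using f_nonzero[OF x] by (simp add: gamma1_def divide_inverse[symmetric] power2_eq_square field_simps)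
qed

text \<open>
  Integrating $g'' - qg = 2h'$ from $0$ to $x$ gives $2(h(x) - h(0)) = g'(x) - g'(0) - \int_0^x qg$, which is
  twice $\gamma_2\gamma_1 g$.
\<close>

lemma gamma21_eq_diff:
  assumes g: "\<And>x. x \<in> {0..b} \<Longrightarrow> (g has_vector_derivative g' x) (at x within {0..b})"
    and g': "\<And>x. x \<in> {0..b} \<Longrightarrow> (g' has_vector_derivative q x * g x + 2 * h' x) (at x within {0..b})"
    and h: "\<And>x. x \<in> {0..b} \<Longrightarrow> (h has_vector_derivative h' x) (at x within {0..b})"
    and x: "x \<in> {0..b}"
  shows "gamma21 b q g x = h x - h 0"
proof -
  \<comment> \<open>$g' - 2h$ is a primitive of $qg$, which gives the integral in the operator directly.\<close>
  have "((\<lambda>s. q s * g s) has_integral (g' x - 2 * h x) - (g' 0 - 2 * h 0)) {0..x}"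
  proof (rule fundamental_theorem_of_calculus)
    fix s assume s: "s \<in> {0..x}"
    then have "s \<in> {0..b}" using x by auto
    then have "((\<lambda>s. g' s - 2 * h s) has_vector_derivative q s * g s + 2 * h' s - 2 * h' s) (at s within {0..b})"
      by (intro has_vector_derivative_diff has_vector_derivative_mult_right g' h)
    then show "((\<lambda>s. g' s - 2 * h s) has_vector_derivative q s * g s) (at s within {0..x})"
      using x by (auto intro: has_vector_derivative_within_subset)
  qed (use x in auto)
  then have "integral {0..x} (\<lambda>s. q s * g s) = (g' x - 2 * h x) - (g' 0 - 2 * h 0)"
    by (rule integral_unique)
  moreover have "D_on b g x = g' x" "D_on b g 0 = g' 0"
    using b_pos x by (auto intro!: D_on_eq g)
  ultimately show ?thesis by (simp add: gamma21_def)
qed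

section \<open>The formal powers\<close>

lemma powi_weight: "((f s)\<^sup>2) powi ((-1) ^ n) = (if even n then (f s)\<^sup>2 else inverse ((f s)\<^sup>2))"
  by simp

lemma weight_cont: "continuous_on {0..b} (\<lambda>s. ((f s)\<^sup>2) powi ((-1) ^ n))"
  using f_nonzero by (cases "even n") (auto intro!: continuous_intros f_cont)

lemma X_0: "X f 0 = (\<lambda>_. 1)" "X_tilde f 0 = (\<lambda>_. 1)"
  by auto

lemma X_cont: "continuous_on {0..b} (X f n)"
  by (induction n)
    (auto intro!: continuous_intros indefinite_integral_continuous_1 integrable_continuous_real weight_cont
      simp del: of_nat_Suc power_Suc)

lemma X_tilde_cont: "continuous_on {0..b} (X_tilde f n)"
  by (induction n)
    (auto intro!: continuous_intros indefinite_integral_continuous_1 integrable_continuous_real weight_cont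
      simp del: of_nat_Suc power_Suc)

lemma X_deriv:
  assumes "x \<in> {0..b}"
  shows "(X f n has_vector_derivative of_nat n * (X f (n - 1) x * ((f x)\<^sup>2) powi ((-1) ^ n))) (at x within {0..b})"
proof (cases n)
  case (Suc m)
  have "((\<lambda>x. of_nat (Suc m) * integral {0..x} (\<lambda>s. X f m s * ((f s)\<^sup>2) powi ((-1) ^ Suc m))) has_vector_derivative
     of_nat (Suc m) * (X f m x * ((f x)\<^sup>2) powi ((-1) ^ Suc m))) (at x within {0..b})"
    using assms
    by (intro has_vector_derivative_mult_right integral_has_vector_derivative continuous_on_mult X_cont weight_cont)
  then show ?thesis unfolding Suc X.simps[abs_def] by simp
qed (simp add: X_0)

lemma X_tilde_deriv:
  assumes "x \<in> {0..b}"
  shows "(X_tilde f n has_vector_derivative of_nat n * (X_tilde f (n - 1) x * ((f x)\<^sup>2) powi ((-1) ^ (n - 1)))) (at x within {0..b})"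
proof (cases n)
  case (Suc m)
  have "((\<lambda>x. of_nat (Suc m) * integral {0..x} (\<lambda>s. X_tilde f m s * ((f s)\<^sup>2) powi ((-1) ^ m))) has_vector_derivative
     of_nat (Suc m) * (X_tilde f m x * ((f x)\<^sup>2) powi ((-1) ^ m))) (at x within {0..b})"
    using assms
    by (intro has_vector_derivative_mult_right integral_has_vector_derivative continuous_on_mult X_tilde_cont weight_cont)
  then show ?thesis unfolding Suc X_tilde.simps[abs_def] by simp
qed (simp add: X_0)

text \<open>
  $\varphi_k = f\,Y_k$, where $Y_k$ is \<open>phi_ratio k\<close>. In both parities
  $f^2 Y_k' = k\,Z_k$ with $Z_k$ being \<open>phi_flux k\<close>, and
  $Z_k' = (k-1) f^2\, Y_{k-2}$; this pair of first-order equations hides the alternation of the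
  weights $f^{2}$ and $f^{-2}$ between the two families of iterated integrals.
\<close>

definition phi_ratio :: "nat \<Rightarrow> real \<Rightarrow> complex" where
  "phi_ratio k = (if odd k then X f k else X_tilde f k)"

definition phi_flux :: "nat \<Rightarrow> real \<Rightarrow> complex" where
  "phi_flux k = (if odd k then X f (k - 1) else X_tilde f (k - 1))"

lemma phi_eq: "phi f k x = f x * phi_ratio k x"
  by (simp add: phi_def phi_ratio_def)

lemma phi_ratio_0: "phi_ratio k 0 = (if k = 0 then 1 else 0)"
  by (cases k) (auto simp: phi_ratio_def)

lemma phi_flux_0: "2 \<le> k \<Longrightarrow> phi_flux k 0 = 0"
  by (cases "k - 1") (auto simp: phi_flux_def)

lemma phi_ratio_deriv:
  assumes "x \<in> {0..b}"
  shows "(phi_ratio k has_vector_derivative of_nat k * (phi_flux k x / (f x)\<^sup>2)) (at x within {0..b})"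
proof (cases "k = 0")
  case False
  then show ?thesis
    using X_deriv[OF assms, of k] X_tilde_deriv[OF assms, of k] unfolding powi_weight
    by (auto simp: phi_ratio_def phi_flux_def divide_inverse)
next
  case True
  then show ?thesis by (simp add: phi_ratio_def X_0)
qed

lemma phi_flux_deriv:
  assumes "x \<in> {0..b}"
  shows "(phi_flux k has_vector_derivative of_nat (k - 1) * (phi_ratio (k - 2) x * (f x)\<^sup>2)) (at x within {0..b})"
proof (cases "k \<le> 1")
  case True
  then show ?thesis by (auto simp: phi_flux_def le_Suc_eq X_0)
next
  case False
  then have "k - 1 - 1 = k - 2" "even (k - 2) = even k" "even (k - 1 - 1) = even k" "even (k - 1) = odd k" by auto
  then show ?thesis
    using X_deriv[OF assms, of "k - 1"] X_tilde_deriv[OF assms, of "k - 1"] unfolding powi_weight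
    by (auto simp: phi_ratio_def phi_flux_def)
qed

definition phi' :: "nat \<Rightarrow> real \<Rightarrow> complex" where
  "phi' k x = f' x * phi_ratio k x + of_nat k * (phi_flux k x * inverse (f x))"

lemma phi_deriv:
  assumes x: "x \<in> {0..b}"
  shows "(phi f k has_vector_derivative phi' k x) (at x within {0..b})"
proof -
  have "((\<lambda>x. f x * phi_ratio k x) has_vector_derivative f x * (of_nat k * (phi_flux k x / (f x)\<^sup>2)) + f' x * phi_ratio k x) (at x within {0..b})"
    by (intro has_vector_derivative_mult f_deriv phi_ratio_deriv x)
  then show ?thesis
    using f_nonzero[OF x] by (simp add: phi_eq[abs_def] phi'_def power2_eq_square field_simps)
qed

text \<open>
  The substitution $\varphi = fY$ turns $\varphi'' - q\varphi$ into $(f^2Y')'/f$, because $f'' = qf$. With the two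
  first-order equations this is $k(k-1) f\,Y_{k-2}$. The index is written \<^term>\<open>k - 1 - 1\<close> to
  match two applications of \<open>binom_conv_weight_index\<close>.
\<close>

lemma phi'_deriv:
  assumes x: "x \<in> {0..b}"
  shows "(phi' k has_vector_derivative q x * phi f k x + of_nat k * (of_nat (k - 1) * phi f (k - 1 - 1) x)) (at x within {0..b})"
proof -
  have "((\<lambda>x. f' x * phi_ratio k x + of_nat k * (phi_flux k x * inverse (f x))) has_vector_derivative
     (f' x * (of_nat k * (phi_flux k x / (f x)\<^sup>2)) + q x * f x * phi_ratio k x)
     + of_nat k * (phi_flux k x * (- f' x / (f x)\<^sup>2) + of_nat (k - 1) * (phi_ratio (k - 2) x * (f x)\<^sup>2) * inverse (f x))) (at x within {0..b})"
    by (intro has_vector_derivative_add has_vector_derivative_mult has_vector_derivative_mult_right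
        f'_deriv phi_ratio_deriv phi_flux_deriv inverse_f_deriv x)
  also have "(f' x * (of_nat k * (phi_flux k x / (f x)\<^sup>2)) + q x * f x * phi_ratio k x)
     + of_nat k * (phi_flux k x * (- f' x / (f x)\<^sup>2) + of_nat (k - 1) * (phi_ratio (k - 2) x * (f x)\<^sup>2) * inverse (f x))
     = q x * (f x * phi_ratio k x) + of_nat k * (of_nat (k - 1) * (f x * phi_ratio (k - 2) x))"
    using f_nonzero[OF x] by (simp add: power2_eq_square field_simps del: of_nat_diff)
  also have "k - 2 = k - 1 - 1" by simp
  finally show ?thesis by (simp only: phi_eq phi'_def[abs_def])
qed

section \<open>The binomial sums of both signs\<close>

definition wave :: "nat \<Rightarrow> complex \<Rightarrow> real \<Rightarrow> complex" where
  "wave m \<epsilon> x = binom_conv (\<lambda>j. phi f j x) m (\<epsilon> * of_real x)"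

definition wave' :: "nat \<Rightarrow> complex \<Rightarrow> real \<Rightarrow> complex" where
  "wave' m \<epsilon> x = \<epsilon> * (of_nat m * wave (m - 1) \<epsilon> x) + binom_conv (\<lambda>j. phi' j x) m (\<epsilon> * of_real x)"

lemma wave_deriv:
  assumes x: "x \<in> {0..b}"
  shows "(wave m \<epsilon> has_vector_derivative wave' m \<epsilon> x) (at x within {0..b})"
  unfolding wave_def wave'_def by (intro has_vector_derivative_binom_conv phi_deriv x)

text \<open>
  The product rule for $u''$ gives three groups of terms. Differentiating the powers twice and
  differentiating the $\varphi_j$ twice both yield $m(m-1)u_{m-2}$, the latter next to $q u_m$; the mixed group is
  twice the part of $\varepsilon m\,u_{m-1}'$ in which a $\varphi_j$ is differentiated. Since $\varepsilon^2 = 1$, the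
  first two groups together are twice the remaining part of $\varepsilon m\,u_{m-1}'$.
\<close>

lemma wave'_deriv:
  assumes x: "x \<in> {0..b}" and \<epsilon>: "\<epsilon>\<^sup>2 = 1"
  shows "(wave' m \<epsilon> has_vector_derivative
           q x * wave m \<epsilon> x + 2 * (\<epsilon> * (of_nat m * wave' (m - 1) \<epsilon> x))) (at x within {0..b})"
proof -
  let ?t = "\<epsilon> * of_real x"
  let ?phi'' = "\<lambda>k. q x * phi f k x + of_nat k * (of_nat (k - 1) * phi f (k - 1 - 1) x)"
  have "binom_conv ?phi'' m ?t = q x * wave m \<epsilon> x
      + binom_conv (\<lambda>k. of_nat k * (of_nat (k - 1) * phi f (k - 1 - 1) x)) m ?t"
    by (simp add: binom_conv_def wave_def sum.distrib sum_distrib_left algebra_simps del: of_nat_diff)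
  also have "binom_conv (\<lambda>k. of_nat k * (of_nat (k - 1) * phi f (k - 1 - 1) x)) m ?t
      = of_nat m * (of_nat (m - 1) * wave (m - 1 - 1) \<epsilon> x)"
    unfolding wave_def
    using binom_conv_weight_index[of "\<lambda>i. of_nat i * phi f (i - 1) x" m ?t]
      binom_conv_weight_index[of "\<lambda>i. phi f i x" "m - 1" ?t] by simp
  finally have conv: "binom_conv ?phi'' m ?t = q x * wave m \<epsilon> x + of_nat m * (of_nat (m - 1) * wave (m - 1 - 1) \<epsilon> x)" .
  have "(wave' m \<epsilon> has_vector_derivative \<epsilon> * (of_nat m * wave' (m - 1) \<epsilon> x)
      + (\<epsilon> * (of_nat m * binom_conv (\<lambda>j. phi' j x) (m - 1) ?t) + binom_conv ?phi'' m ?t)) (at x within {0..b})"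
    unfolding wave'_def[of m, abs_def]
    by (intro has_vector_derivative_add has_vector_derivative_mult_right wave_deriv
        has_vector_derivative_binom_conv phi'_deriv x)
  also have "\<epsilon> * (of_nat m * wave' (m - 1) \<epsilon> x)
      + (\<epsilon> * (of_nat m * binom_conv (\<lambda>j. phi' j x) (m - 1) ?t) + binom_conv ?phi'' m ?t)
     = q x * wave m \<epsilon> x + 2 * (\<epsilon> * (of_nat m * wave' (m - 1) \<epsilon> x))
       + (1 - \<epsilon>\<^sup>2) * (of_nat m * (of_nat (m - 1) * wave (m - 1 - 1) \<epsilon> x))"
    unfolding conv by (simp only: wave'_def) (simp add: algebra_simps power2_eq_square del: of_nat_diff)
  finally show ?thesis using \<epsilon> by simp
qed

lemma wave_at_0: "wave m \<epsilon> 0 = (if m = 0 then 1 else 0)"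
  by (simp add: wave_def binom_conv_0 phi_eq phi_ratio_0 f_0)

text \<open>
  Together with \<open>wave_at_0\<close> this says that $u_m$ and its derivative vanish at $0$ for $m \ge 2$,
  which makes the Wronskian with $f$ vanish there.
\<close>

lemma wave'_at_0: "2 \<le> m \<Longrightarrow> wave' m \<epsilon> 0 = 0"
  by (simp add: wave'_def wave_at_0 binom_conv_0 phi'_def phi_ratio_0 phi_flux_0)

text \<open>
  The weights $\alpha = \pm\beta$ give multiples of $\mathbf{c}_m$ and $\mathbf{s}_m$. Free weights
  let one computation cover both families and their scaling by $1/n!$; the exchange of $\mathbf{c}$
  and $\mathbf{s}$ becomes the sign change $\beta \mapsto -\beta$.
\<close>

definition wave_comb :: "nat \<Rightarrow> complex \<Rightarrow> complex \<Rightarrow> real \<Rightarrow> complex" where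
  "wave_comb m \<alpha> \<beta> x = \<alpha> * wave m 1 x + \<beta> * wave m (-1) x"

lemma wave_comb_deriv:
  assumes "x \<in> {0..b}"
  shows "(wave_comb m \<alpha> \<beta> has_vector_derivative \<alpha> * wave' m 1 x + \<beta> * wave' m (-1) x) (at x within {0..b})"
  unfolding wave_comb_def
  by (intro has_vector_derivative_add has_vector_derivative_mult_right wave_deriv assms)

lemma wave_comb_deriv2:
  assumes "x \<in> {0..b}"
  shows "((\<lambda>x. \<alpha> * wave' m 1 x + \<beta> * wave' m (-1) x) has_vector_derivative
    q x * wave_comb m \<alpha> \<beta> x + 2 * (of_nat m * (\<alpha> * wave' (m - 1) 1 x + - \<beta> * wave' (m - 1) (-1) x))) (at x within {0..b})"
proof -
  have "((\<lambda>x. \<alpha> * wave' m 1 x + \<beta> * wave' m (-1) x) has_vector_derivative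
    \<alpha> * (q x * wave m 1 x + 2 * (1 * (of_nat m * wave' (m - 1) 1 x)))
    + \<beta> * (q x * wave m (-1) x + 2 * (-1 * (of_nat m * wave' (m - 1) (-1) x)))) (at x within {0..b})"
    by (intro has_vector_derivative_add has_vector_derivative_mult_right wave'_deriv assms) simp_all
  then show ?thesis by (simp add: wave_comb_def algebra_simps)
qed

lemma C1_on_wave_comb: "C1_on b (wave_comb m \<alpha> \<beta>)"
proof -
  have "continuous_on {0..b} (\<lambda>x. \<alpha> * wave' m 1 x + \<beta> * wave' m (-1) x)"
    by (rule continuous_on_vector_derivative[OF wave_comb_deriv2])
  then show ?thesis unfolding C1_on_def
    by (intro exI[of _ "\<lambda>x. \<alpha> * wave' m 1 x + \<beta> * wave' m (-1) x"] conjI ballI wave_comb_deriv)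
qed

lemma gamma21_wave_comb:
  assumes "x \<in> {0..b}"
  shows "gamma21 b q (wave_comb m \<alpha> \<beta>) x
     = of_nat m * wave_comb (m - 1) \<alpha> (- \<beta>) x - of_nat m * wave_comb (m - 1) \<alpha> (- \<beta>) 0"
  by (rule gamma21_eq_diff[OF wave_comb_deriv wave_comb_deriv2 _ assms],
    assumption, assumption, intro has_vector_derivative_mult_right wave_comb_deriv)

lemma gamma1_wave_comb_at_0: "2 \<le> m \<Longrightarrow> gamma1 b f (wave_comb m \<alpha> \<beta>) 0 = 0"
  using gamma1_eq[OF _ wave_comb_deriv, of 0 m \<alpha> \<beta>] b_pos
  by (simp add: wave'_at_0 wave_comb_def wave_at_0)

lemma c_fun_scaled: "(\<lambda>t. c_fun f n t / r) = wave_comb n (1 / (2 * r)) (1 / (2 * r))"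
  by (simp add: fun_eq_iff c_fun_eq_binom_conv wave_comb_def wave_def add_divide_distrib)

lemma s_fun_scaled: "(\<lambda>t. s_fun f n t / r) = wave_comb n (1 / (2 * r)) (- (1 / (2 * r)))"
  by (simp add: fun_eq_iff s_fun_eq_binom_conv wave_comb_def wave_def diff_divide_distrib)

section \<open>Regularity of the iterates on \<open>f - 1\<close>\<close>

text \<open>
  The function $g = f - 1$ solves $g'' - qg = q$, and $q$ is twice the derivative of
  $\frac12\int_0^x q$.
\<close>

lemma gamma21_f_minus_1:
  assumes "x \<in> {0..b}"
  shows "gamma21 b q (\<lambda>t. f t - 1) x = 1/2 * integral {0..x} q"
proof -
  have "gamma21 b q (\<lambda>t. f t - 1) x = 1/2 * integral {0..x} q - 1/2 * integral {0..0} q"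
  proof (rule gamma21_eq_diff[OF _ _ _ assms])
    fix y assume y: "y \<in> {0..b}"
    show "((\<lambda>t. f t - 1) has_vector_derivative f' y) (at y within {0..b})"
      using has_vector_derivative_diff[OF f_deriv[OF y] has_vector_derivative_const[of 1]] by simp
    show "(f' has_vector_derivative q y * (f y - 1) + 2 * (1/2 * q y)) (at y within {0..b})"
      using f'_deriv[OF y] by (simp add: algebra_simps)
    show "((\<lambda>x. 1/2 * integral {0..x} q) has_vector_derivative 1/2 * q y) (at y within {0..b})"
      by (intro has_vector_derivative_mult_right integral_has_vector_derivative q_cont y)
  qed
  then show ?thesis by simp
qed

lemma Ck_on_gamma21:
  assumes g: "Ck_on (Suc k) b g" and q: "Ck_on k b q"
  shows "Ck_on k b (gamma21 b q g)"
proof -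
  obtain g' where "\<forall>x\<in>{0..b}. (g has_vector_derivative g' x) (at x within {0..b})" and Ck: "Ck_on k b g'"
    using g by auto
  then have g': "(g has_vector_derivative g' x) (at x within {0..b})" if "x \<in> {0..b}" for x
    using that by blast
  have "Ck_on k b (\<lambda>x. 1/2 * (g' x - g' 0 - integral {0..x} (\<lambda>s. q s * g s)))"
    by (intro Ck_on_mult Ck_on_diff Ck_on_const Ck Ck_on_Suc_imp[OF Ck_on_integral] q Ck_on_Suc_imp[OF g])
  moreover have "gamma21 b q g x = 1/2 * (g' x - g' 0 - integral {0..x} (\<lambda>s. q s * g s))" if "x \<in> {0..b}" for x
    using D_on_eq[OF b_pos _ g'] that b_pos by (simp add: gamma21_def)
  ultimately show ?thesis by (subst Ck_on_cong)
qed

lemma Ck_on_f_minus_1: "Ck_on (Suc 0) b (\<lambda>t. f t - 1)"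
proof -
  have "continuous_on {0..b} f'" by (rule continuous_on_vector_derivative[OF f'_deriv])
  then have "Ck_on (Suc 0) b f" unfolding Ck_on.simps
    by (intro exI[of _ f'] conjI ballI f_deriv)
  then show ?thesis by (intro Ck_on_diff Ck_on_const)
qed

text \<open>
  The first application lands in $C^{k+1}$ because its value is an integral of $q$; every further one
  loses a derivative. Starting the induction there, not at $f - 1$ itself, is what makes the count reach $C^1$ for
  $k + 1$ applications.
\<close>

lemma Ck_on_gamma21_iterate_f_minus_1:
  assumes q: "Ck_on k b q" and i: "i \<le> k"
  shows "Ck_on (Suc (k - i)) b ((gamma21 b q ^^ Suc i) (\<lambda>t. f t - 1))"
  using i
proof (induction i)
  case 0
  have "Ck_on (Suc k) b (\<lambda>x. 1/2 * integral {0..x} q)"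
    by (intro Ck_on_mult Ck_on_const Ck_on_integral q)
  moreover have "Ck_on (Suc k) b (gamma21 b q (\<lambda>t. f t - 1)) = Ck_on (Suc k) b (\<lambda>x. 1/2 * integral {0..x} q)"
    by (rule Ck_on_cong) (rule gamma21_f_minus_1)
  ultimately show ?case by simp
next
  case (Suc i)
  then have k: "k - i = Suc (k - Suc i)" by simp
  have "Ck_on (Suc (Suc (k - Suc i))) b ((gamma21 b q ^^ Suc i) (\<lambda>t. f t - 1))"
    using Suc k by (simp only:) 
  moreover have "Ck_on (Suc (k - Suc i)) b q" using q Suc.prems by (auto intro: Ck_on_antimono[rotated] simp del: Ck_on.simps)
  ultimately have "Ck_on (Suc (k - Suc i)) b (gamma21 b q ((gamma21 b q ^^ Suc i) (\<lambda>t. f t - 1)))"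
    by (rule Ck_on_gamma21)
  then show ?case by simp
qed

text \<open>
  For $k \ge 1$ the Sobolev embedding gives $q \in C^{k-1}$, which keeps $k$ applications inside $C^1$;
  for $k = 0$ only $f - 1$ itself occurs, and $f'$ is continuous because it has a derivative.
\<close>

lemma C1_on_gamma21_iterate_f_minus_1:
  assumes "W2 k b q" "i \<le> k"
  shows "C1_on b ((gamma21 b q ^^ i) (\<lambda>t. f t - 1))"
proof (cases i)
  case 0
  then show ?thesis using Ck_on_f_minus_1 by (simp add: C1_on_iff)
next
  case (Suc j)
  then obtain l where k: "k = Suc l" "j \<le> l" using assms(2) by (cases k) auto
  then have "Ck_on l b q" using assms(1) W2_Suc_imp_Ck_on by blast
  from Ck_on_gamma21_iterate_f_minus_1[OF this k(2)] have "Ck_on (Suc 0) b ((gamma21 b q ^^ Suc j) (\<lambda>t. f t - 1))"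
    by (rule Ck_on_antimono[rotated]) simp
  then show ?thesis by (simp add: C1_on_iff Suc del: Ck_on.simps)
qed

section \<open>The families \<open>c_fun\<close> and \<open>s_fun\<close>\<close>

lemmas c_fun_wave_comb = c_fun_scaled[where r = 1, simplified]
lemmas s_fun_wave_comb = s_fun_scaled[where r = 1, simplified]

lemma C1_on_scaled: "C1_on b (\<lambda>t. c_fun f n t / r)" "C1_on b (\<lambda>t. s_fun f n t / r)"
  unfolding c_fun_scaled s_fun_scaled by (rule C1_on_wave_comb)+

lemma gamma21_c_fun_scaled:
  assumes "x \<in> {0..b}"
  shows "gamma21 b q (\<lambda>t. c_fun f n t / r) x = of_nat n * (s_fun f (n - 1) x / r)"
  using gamma21_wave_comb[OF assms, of n "1 / (2 * r)" "1 / (2 * r)"] fun_cong[OF s_fun_scaled[of "n - 1" r], of x]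
  by (simp add: c_fun_scaled wave_comb_def[of _ _ _ 0] wave_at_0)

text \<open>
  The subtracted constant is $n\,\mathbf{c}_{n-1}(0)/r$. It survives only for $n = 1$, where it is the value
  $f(0) = 1$; in the companion rule above it is absent because $\mathbf{s}_{n-1}(0) = 0$ for every $n$.
\<close>

lemma gamma21_s_fun_scaled:
  assumes "x \<in> {0..b}"
  shows "gamma21 b q (\<lambda>t. s_fun f n t / r) x
    = of_nat n * (c_fun f (n - 1) x / r) - (if n = 1 then 1 / r else 0)"
  using gamma21_wave_comb[OF assms, of n "1 / (2 * r)" "- (1 / (2 * r))"] fun_cong[OF c_fun_scaled[of "n - 1" r], of x]
  by (cases "n = 0") (auto simp add: s_fun_scaled wave_comb_def[of _ _ _ 0] wave_at_0 simp flip: add_divide_distrib)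

lemma of_nat_div_fact: "1 \<le> n \<Longrightarrow> of_nat n * (z / fact n) = z / fact (n - 1)" for z :: complex
  by (cases n) (simp_all del: of_nat_Suc)

lemma gamma21_c_fun_step:
  assumes "1 \<le> n" "x \<in> {0..b}"
  shows "gamma21 b q (\<lambda>t. c_fun f n t / fact n) x = s_fun f (n - 1) x / fact (n - 1)"
  using gamma21_c_fun_scaled[OF assms(2)] of_nat_div_fact[OF assms(1)] by simp

lemma gamma21_s_fun_step:
  assumes "1 \<le> n" "x \<in> {0..b}"
  shows "gamma21 b q (\<lambda>t. s_fun f n t / fact n) x = c_fun f (n - 1) x / fact (n - 1) - (if n = 1 then 1 else 0)"
  using gamma21_s_fun_scaled[OF assms(2), of n "fact n"] of_nat_div_fact[OF assms(1)] by simp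

lemma gamma21_first:
  assumes "x \<in> {0..b}"
  shows "gamma21 b q (\<lambda>t. c_fun f 1 t / fact 1) x = 0"
    "gamma21 b q (\<lambda>t. s_fun f 1 t / fact 1) x = f x - 1"
  using gamma21_c_fun_step[OF _ assms, of 1] gamma21_s_fun_step[OF _ assms, of 1]
  by (simp_all add: s_fun_def[of f 0] c_fun_def[of f 0])

lemma iterate_c_fun:
  assumes "1 \<le> n" "x \<in> {0..b}"
  shows "(gamma21 b q ^^ i) (\<lambda>t. c_fun f n t / fact n) x =
    (if i < n then if even i then c_fun f (n - i) x / fact (n - i) else s_fun f (n - i) x / fact (n - i)
     else if even n then (gamma21 b q ^^ (i - n)) (\<lambda>t. f t - 1) x else 0)"
proof -
  have "(gamma21 b q ^^ i) (\<lambda>t. c_fun f n t / fact n) x =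
    (if i < n then if even i then c_fun f (n - i) x / fact (n - i) else s_fun f (n - i) x / fact (n - i)
     else (gamma21 b q ^^ (i - n)) (if odd n then (\<lambda>_. 0) else (\<lambda>t. f t - 1)) x)"
    by (rule gamma21_iterate_alternating[where A = "\<lambda>n t. c_fun f n t / fact n"
          and B = "\<lambda>n t. s_fun f n t / fact n", OF _ _ gamma21_first assms])
      (simp_all add: gamma21_c_fun_step gamma21_s_fun_step)
  then show ?thesis using gamma21_iterate_zero[OF b_pos assms(2)] by simp
qed

lemma iterate_s_fun:
  assumes "1 \<le> n" "x \<in> {0..b}"
  shows "(gamma21 b q ^^ i) (\<lambda>t. s_fun f n t / fact n) x =
    (if i < n then if even i then s_fun f (n - i) x / fact (n - i) else c_fun f (n - i) x / fact (n - i)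
     else if odd n then (gamma21 b q ^^ (i - n)) (\<lambda>t. f t - 1) x else 0)"
proof -
  have "(gamma21 b q ^^ i) (\<lambda>t. s_fun f n t / fact n) x =
    (if i < n then if even i then s_fun f (n - i) x / fact (n - i) else c_fun f (n - i) x / fact (n - i)
     else (gamma21 b q ^^ (i - n)) (if odd n then (\<lambda>t. f t - 1) else (\<lambda>_. 0)) x)"
    by (rule gamma21_iterate_alternating[where A = "\<lambda>n t. s_fun f n t / fact n"
          and B = "\<lambda>n t. c_fun f n t / fact n", OF _ _ gamma21_first(2,1) assms])
      (simp_all add: gamma21_c_fun_step gamma21_s_fun_step)
  then show ?thesis using gamma21_iterate_zero[OF b_pos assms(2)] by simp
qed

lemma iterate_vanishing:
  assumes "\<And>x. x \<in> {0..b} \<Longrightarrow> gamma21 b q g x = 0" "1 \<le> i" "x \<in> {0..b}"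
  shows "(gamma21 b q ^^ i) g x = 0"
proof -
  obtain k where k: "i = Suc k" using assms(2) by (cases i) auto
  have "(gamma21 b q ^^ i) g x = (gamma21 b q ^^ k) (gamma21 b q g) x"
    by (simp add: k funpow_swap1)
  also have "\<dots> = (gamma21 b q ^^ k) (\<lambda>_. 0) x"
    using assms(1,3) by (rule gamma21_iterate_cong)
  finally show ?thesis by (simp add: gamma21_iterate_zero[OF b_pos assms(3)])
qed

lemma iterate_zeroth:
  assumes "1 \<le> i" "x \<in> {0..b}"
  shows "(gamma21 b q ^^ i) (\<lambda>t. c_fun f 0 t / fact 0) x = 0"
    "(gamma21 b q ^^ i) (\<lambda>t. s_fun f 0 t / fact 0) x = 0"
proof -
  have "gamma21 b q (\<lambda>t. c_fun f 0 t / fact 0) y = 0" if "y \<in> {0..b}" for y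
    using gamma21_c_fun_scaled[OF that, of 0 "fact 0"] by simp
  then show "(gamma21 b q ^^ i) (\<lambda>t. c_fun f 0 t / fact 0) x = 0"
    using assms by (rule iterate_vanishing)
  have "gamma21 b q (\<lambda>t. s_fun f 0 t / fact 0) y = 0" if "y \<in> {0..b}" for y
    using gamma21_s_fun_scaled[OF that, of 0 "fact 0"] by simp
  then show "(gamma21 b q ^^ i) (\<lambda>t. s_fun f 0 t / fact 0) x = 0"
    using assms by (rule iterate_vanishing)
qed

lemma iterate_defined_c_fun:
  assumes "n < j \<and> 0 < n \<and> even n \<longrightarrow> W2 (j - n - 1) b q"
  shows "iterate_defined b q j (\<lambda>t. c_fun f n t / fact n)"
  unfolding iterate_defined_def
proof (intro allI impI)
  fix i assume "i < j"
  show "C1_on b ((gamma21 b q ^^ i) (\<lambda>t. c_fun f n t / fact n))"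
  proof (cases "n = 0")
    case True
    then show ?thesis
      using C1_on_cong[OF iterate_zeroth(1)[of i]] C1_on_zero C1_on_scaled(1)[of 0 "fact 0"]
      by (cases "i = 0") auto
  next
    case False
    show ?thesis
      by (subst C1_on_cong[OF iterate_c_fun]; cases "i < n"; cases "even i"; cases "even n";
        use False \<open>i < j\<close> assms in \<open>auto intro: C1_on_scaled C1_on_zero C1_on_gamma21_iterate_f_minus_1\<close>)
  qed
qed

lemma iterate_defined_s_fun:
  assumes "n < j \<and> odd n \<longrightarrow> W2 (j - n - 1) b q"
  shows "iterate_defined b q j (\<lambda>t. s_fun f n t / fact n)"
  unfolding iterate_defined_def
proof (intro allI impI)
  fix i assume "i < j"
  show "C1_on b ((gamma21 b q ^^ i) (\<lambda>t. s_fun f n t / fact n))"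
  proof (cases "n = 0")
    case True
    then show ?thesis
      using C1_on_cong[OF iterate_zeroth(2)[of i]] C1_on_zero C1_on_scaled(2)[of 0 "fact 0"]
      by (cases "i = 0") auto
  next
    case False
    show ?thesis
      by (subst C1_on_cong[OF iterate_s_fun]; cases "i < n"; cases "even i"; cases "even n";
        use False \<open>i < j\<close> assms in \<open>auto intro: C1_on_scaled C1_on_zero C1_on_gamma21_iterate_f_minus_1\<close>)
  qed
qed

text \<open>
  The Wronskians of $f$ with $\mathbf{c}_0 = f$, $\mathbf{c}_1 = \varphi_1$ and $\mathbf{s}_1 = xf$; the middle one is
  $f^2 (\varphi_1/f)' = 1$.
\<close>

lemma gamma1_low_degree:
  assumes x: "x \<in> {0..b}"
  shows "gamma1 b f (c_fun f 0) x = 0" "gamma1 b f (c_fun f 1) x = 1" "gamma1 b f (s_fun f 1) x = (f x)\<^sup>2"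
proof -
  have c0: "c_fun f 0 = f" by (simp add: fun_eq_iff c_fun_def)
  show "gamma1 b f (c_fun f 0) x = 0"
    unfolding c0 using gamma1_eq[OF x f_deriv[OF x]] by simp
  have c1: "c_fun f 1 = phi f 1"
    by (simp add: fun_eq_iff c_fun_eq_binom_conv binom_conv_def algebra_simps flip: add_divide_distrib)
  show "gamma1 b f (c_fun f 1) x = 1"
    unfolding c1 using gamma1_eq[OF x phi_deriv[OF x, of 1]] f_nonzero[OF x]
    by (simp add: phi_eq phi'_def phi_flux_def algebra_simps)
  have s1: "s_fun f 1 = (\<lambda>x. of_real x * f x)"
    by (simp add: fun_eq_iff s_fun_eq_binom_conv binom_conv_def phi_def algebra_simps)
  have "((\<lambda>x. of_real x * f x) has_vector_derivative of_real x * f' x + 1 * f x) (at x within {0..b})"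
    by (intro has_vector_derivative_mult f_deriv x has_vector_derivative_real_field) (auto intro!: derivative_eq_intros)
  from gamma1_eq[OF x this] show "gamma1 b f (s_fun f 1) x = (f x)\<^sup>2"
    unfolding s1 by (simp add: power2_eq_square algebra_simps)
qed

end

theorem proposition4p3:
  fixes b :: real and q f :: "real \<Rightarrow> complex"
  assumes "0 < b"
    and "continuous_on {0..b} q"
    and "solves_ode b q f"
    and "f 0 = 1"
    and "\<forall>x\<in>{0..b}. f x \<noteq> 0"
  shows
    "(\<forall>n. C1_on b (c_fun f n) \<and> C1_on b (s_fun f n)) \<and>
     (\<forall>x\<in>{0..b}. gamma1 b f (c_fun f 0) x = 0) \<and>
     (\<forall>x\<in>{0..b}. gamma1 b f (c_fun f 1) x = 1) \<and>
     (\<forall>x\<in>{0..b}. gamma1 b f (s_fun f 1) x = (f x)\<^sup>2) \<and>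
     (\<forall>x\<in>{0..b}. gamma21 b q (c_fun f 0) x = 0) \<and>
     (\<forall>x\<in>{0..b}. gamma21 b q (c_fun f 1) x = 0) \<and>
     (\<forall>x\<in>{0..b}. gamma21 b q (s_fun f 1) x = f x - 1) \<and>
     (\<forall>n\<ge>2. gamma1 b f (c_fun f n) 0 = 0 \<and> gamma1 b f (s_fun f n) 0 = 0) \<and>
     (\<forall>n\<ge>1. \<forall>x\<in>{0..b}. gamma21 b q (c_fun f n) x = of_nat n * s_fun f (n - 1) x) \<and>
     (\<forall>n\<ge>2. \<forall>x\<in>{0..b}. gamma21 b q (s_fun f n) x = of_nat n * c_fun f (n - 1) x) \<and>
     (\<forall>j\<ge>1. \<forall>n.
        (j > n \<and> n > 0 \<and> even n \<longrightarrow> W2 (j - n - 1) b q) \<longrightarrow>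
        iterate_defined b q j (\<lambda>t. c_fun f n t / fact n) \<and>
        (\<forall>x\<in>{0..b}. (gamma21 b q ^^ j) (\<lambda>t. c_fun f n t / fact n) x =
           (if odd j \<and> j < n then s_fun f (n - j) x / fact (n - j)
            else if even j \<and> j < n then c_fun f (n - j) x / fact (n - j)
            else if j \<ge> n \<and> n > 0 \<and> even n then (gamma21 b q ^^ (j - n)) (\<lambda>t. f t - 1) x
            else 0))) \<and>
     (\<forall>j\<ge>1. \<forall>n.
        (j > n \<and> odd n \<longrightarrow> W2 (j - n - 1) b q) \<longrightarrow>
        iterate_defined b q j (\<lambda>t. s_fun f n t / fact n) \<and>
        (\<forall>x\<in>{0..b}. (gamma21 b q ^^ j) (\<lambda>t. s_fun f n t / fact n) x =
           (if odd j \<and> j < n then c_fun f (n - j) x / fact (n - j)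
            else if even j \<and> j < n then s_fun f (n - j) x / fact (n - j)
            else if j \<ge> n \<and> odd n then (gamma21 b q ^^ (j - n)) (\<lambda>t. f t - 1) x
            else 0)))"
proof -
  obtain f' where f': "\<forall>x\<in>{0..b}. (f has_vector_derivative f' x) (at x within {0..b})"
    "\<forall>x\<in>{0..b}. (f' has_vector_derivative q x * f x) (at x within {0..b})"
    using assms(3) unfolding solves_ode_def by blast
  interpret nonvanishing_solution b q f f'
    by (rule nonvanishing_solution.intro)
      (rule assms(1,2,4) f'[rule_format] assms(5)[rule_format], assumption?)+
  have C1: "C1_on b (c_fun f n)" "C1_on b (s_fun f n)" for n
    using C1_on_scaled[of n 1] by simp_all
  have c: "gamma21 b q (c_fun f n) x = of_nat n * s_fun f (n - 1) x" if "x \<in> {0..b}" for n x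
    using gamma21_c_fun_scaled[OF that, of n 1] by simp
  have s: "gamma21 b q (s_fun f n) x = of_nat n * c_fun f (n - 1) x - (if n = 1 then 1 else 0)"
    if "x \<in> {0..b}" for n x
    using gamma21_s_fun_scaled[OF that, of n 1] by simp
  have at_0: "gamma1 b f (c_fun f n) 0 = 0" "gamma1 b f (s_fun f n) 0 = 0" if "2 \<le> n" for n
    unfolding c_fun_wave_comb s_fun_wave_comb using that by (simp_all only: gamma1_wave_comb_at_0)
  have iterate_c: "(gamma21 b q ^^ j) (\<lambda>t. c_fun f n t / fact n) x =
           (if odd j \<and> j < n then s_fun f (n - j) x / fact (n - j)
            else if even j \<and> j < n then c_fun f (n - j) x / fact (n - j)
            else if j \<ge> n \<and> n > 0 \<and> even n then (gamma21 b q ^^ (j - n)) (\<lambda>t. f t - 1) x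
            else 0)" if "1 \<le> j" "x \<in> {0..b}" for j n x
    using that iterate_c_fun[of n x j] iterate_zeroth(1)[of j x] by (cases "n = 0") auto
  have iterate_s: "(gamma21 b q ^^ j) (\<lambda>t. s_fun f n t / fact n) x =
           (if odd j \<and> j < n then c_fun f (n - j) x / fact (n - j)
            else if even j \<and> j < n then s_fun f (n - j) x / fact (n - j)
            else if j \<ge> n \<and> odd n then (gamma21 b q ^^ (j - n)) (\<lambda>t. f t - 1) x
            else 0)" if "1 \<le> j" "x \<in> {0..b}" for j n x
    using that iterate_s_fun[of n x j] iterate_zeroth(2)[of j x] by (cases "n = 0") auto
  have low: "s_fun f 0 x = 0" "c_fun f 0 x = f x" for x
    by (simp_all add: s_fun_def c_fun_def)
  show ?thesis
    by (intro conjI allI impI ballI C1 gamma1_low_degree at_0 iterate_defined_c_fun iterate_defined_s_fun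
        iterate_c iterate_s) (simp_all add: c s low)
qed

end
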